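(* Let $G$ be a graph satisfying the NC property. Then $\chi_{DP}(G)\le \omega(G)+1$. Moreover, if $G$ is $K_n$-minor-free, then $\chi_{DP}(G)\le n-1$.
   Context: All graphs are finite and simple. $\omega(G)$ is the clique number and $\chi_{DP}(G)$ the DP-chromatic (correspondence chromatic) number of $G$. A hole of $G$ is an induced cycle of length at least $4$; $G$ is chordal if it has no hole. $\mathcal H(G)$ denotes the set of holes of $G$ and $\mathcal H(G,u)$ the set of holes of $G$ containing the vertex $u$. A hole cover of $G$ is a nonempty set $X\subseteq V(G)$ such that every hole of $G$ contains a vertex of $X$ (if $G$ is chordal, every nonempty vertex set is a hole cover). A vertex $u$ satisfies the NC property in $G$ if there are no holes $H\in\mathcal H(G,u)$ and $H'\in\mathcal H(G)\setminus\mathcal H(G,u)$ sharing two consecutive edges, i.e. two distinct edges with a common end vertex that both lie on $H$ and on $H'$. A set $\mathcal C\subseteq V(G)$ satisfies the NC property in $G$ if every vertex of $\mathcal C$ satisfies the NC property in $G$ and every hole of $G$ contains at most one vertex of $\mathcal C$. A graph satisfies the NC property if it has a hole cover satisfying the NC property in it. *)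

theory Defs
  imports Main
begin

text \<open>A finite simple graph: finite vertex set V, symmetric irreflexive
  adjacency relation E whose edges lie inside V.\<close>
definition graph :: "'a set \<Rightarrow> ('a \<Rightarrow> 'a \<Rightarrow> bool) \<Rightarrow> bool" where
  "graph V E \<longleftrightarrow> finite V \<and> (\<forall>u v. E u v \<longrightarrow> E v u) \<and> (\<forall>u. \<not> E u u)
     \<and> (\<forall>u v. E u v \<longrightarrow> u \<in> V \<and> v \<in> V)"

text \<open>Clique number.\<close>
definition clique :: "'a set \<Rightarrow> ('a \<Rightarrow> 'a \<Rightarrow> bool) \<Rightarrow> 'a set \<Rightarrow> bool" where
  "clique V E K \<longleftrightarrow> K \<subseteq> V \<and> (\<forall>x\<in>K. \<forall>y\<in>K. x \<noteq> y \<longrightarrow> E x y)"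

definition clique_number :: "'a set \<Rightarrow> ('a \<Rightarrow> 'a \<Rightarrow> bool) \<Rightarrow> nat" where
  "clique_number V E = Max {card K | K. clique V E K}"

text \<open>A hole: (the vertex set of) an induced cycle of length at least 4,
  given by a cyclic list of distinct vertices cs in which two vertices are
  adjacent iff they are cyclically consecutive.\<close>
definition is_hole :: "'a set \<Rightarrow> ('a \<Rightarrow> 'a \<Rightarrow> bool) \<Rightarrow> 'a set \<Rightarrow> bool" where
  "is_hole V E H \<longleftrightarrow> (\<exists>cs. distinct cs \<and> length cs \<ge> 4 \<and> set cs = H \<and> H \<subseteq> V \<and>
     (\<forall>i<length cs. \<forall>j<length cs.
        E (cs!i) (cs!j) \<longleftrightarrow> (j = Suc i mod length cs \<or> i = Suc j mod length cs)))"

definition holes :: "'a set \<Rightarrow> ('a \<Rightarrow> 'a \<Rightarrow> bool) \<Rightarrow> 'a set set" where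
  "holes V E = {H. is_hole V E H}"

definition holes_at :: "'a set \<Rightarrow> ('a \<Rightarrow> 'a \<Rightarrow> bool) \<Rightarrow> 'a \<Rightarrow> 'a set set" where
  "holes_at V E u = {H \<in> holes V E. u \<in> H}"

text \<open>Hole cover.\<close>
definition hole_cover :: "'a set \<Rightarrow> ('a \<Rightarrow> 'a \<Rightarrow> bool) \<Rightarrow> 'a set \<Rightarrow> bool" where
  "hole_cover V E X \<longleftrightarrow> X \<noteq> {} \<and> X \<subseteq> V \<and> (\<forall>H\<in>holes V E. H \<inter> X \<noteq> {})"

text \<open>Two holes share two consecutive edges: distinct edges xy, yz lying on
  both holes (holes are induced, so their edges are exactly the edges of the
  graph between their vertices).\<close>
definition share_consecutive_edges :: "('a \<Rightarrow> 'a \<Rightarrow> bool) \<Rightarrow> 'a set \<Rightarrow> 'a set \<Rightarrow> bool" where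
  "share_consecutive_edges E H H' \<longleftrightarrow>
     (\<exists>x y z. x \<noteq> z \<and> E x y \<and> E y z \<and> {x, y, z} \<subseteq> H \<and> {x, y, z} \<subseteq> H')"

definition NC_vertex :: "'a set \<Rightarrow> ('a \<Rightarrow> 'a \<Rightarrow> bool) \<Rightarrow> 'a \<Rightarrow> bool" where
  "NC_vertex V E u \<longleftrightarrow>
     \<not> (\<exists>H\<in>holes_at V E u. \<exists>H'\<in>holes V E - holes_at V E u. share_consecutive_edges E H H')"

definition NC_set :: "'a set \<Rightarrow> ('a \<Rightarrow> 'a \<Rightarrow> bool) \<Rightarrow> 'a set \<Rightarrow> bool" where
  "NC_set V E C \<longleftrightarrow> C \<subseteq> V \<and> (\<forall>u\<in>C. NC_vertex V E u) \<and>
     (\<forall>H\<in>holes V E. card (H \<inter> C) \<le> 1)"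

definition NC_graph :: "'a set \<Rightarrow> ('a \<Rightarrow> 'a \<Rightarrow> bool) \<Rightarrow> bool" where
  "NC_graph V E \<longleftrightarrow> (\<exists>X. hole_cover V E X \<and> NC_set V E X)"

text \<open>DP-colouring. A k-correspondence assignment M: for every edge uv,
  M u v i j says that colour i of u is matched with colour j of v
  (colours 0..k-1); M is symmetric and on each edge a matching.\<close>
definition correspondence :: "'a set \<Rightarrow> ('a \<Rightarrow> 'a \<Rightarrow> bool) \<Rightarrow> nat \<Rightarrow> ('a \<Rightarrow> 'a \<Rightarrow> nat \<Rightarrow> nat \<Rightarrow> bool) \<Rightarrow> bool" where
  "correspondence V E k M \<longleftrightarrow>
     (\<forall>u v i j. M u v i j \<longleftrightarrow> M v u j i) \<and>
     (\<forall>u v i j j'. E u v \<and> i < k \<and> j < k \<and> j' < k \<and> M u v i j \<and> M u v i j' \<longrightarrow> j = j')"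

definition M_colouring :: "'a set \<Rightarrow> ('a \<Rightarrow> 'a \<Rightarrow> bool) \<Rightarrow> nat \<Rightarrow> ('a \<Rightarrow> 'a \<Rightarrow> nat \<Rightarrow> nat \<Rightarrow> bool) \<Rightarrow> ('a \<Rightarrow> nat) \<Rightarrow> bool" where
  "M_colouring V E k M f \<longleftrightarrow> (\<forall>v\<in>V. f v < k) \<and> (\<forall>u v. E u v \<longrightarrow> \<not> M u v (f u) (f v))"

definition DP_colourable :: "'a set \<Rightarrow> ('a \<Rightarrow> 'a \<Rightarrow> bool) \<Rightarrow> nat \<Rightarrow> bool" where
  "DP_colourable V E k \<longleftrightarrow> (\<forall>M. correspondence V E k M \<longrightarrow> (\<exists>f. M_colouring V E k M f))"

definition chi_DP :: "'a set \<Rightarrow> ('a \<Rightarrow> 'a \<Rightarrow> bool) \<Rightarrow> nat" where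
  "chi_DP V E = (LEAST k. DP_colourable V E k)"

text \<open>K_n minor, via n pairwise disjoint nonempty connected branch sets,
  any two of which are joined by an edge.\<close>
definition connected_in :: "('a \<Rightarrow> 'a \<Rightarrow> bool) \<Rightarrow> 'a set \<Rightarrow> bool" where
  "connected_in E B \<longleftrightarrow>
     (\<forall>x\<in>B. \<forall>y\<in>B. (x, y) \<in> {(a, b). a \<in> B \<and> b \<in> B \<and> E a b}\<^sup>*)"

definition has_complete_minor :: "'a set \<Rightarrow> ('a \<Rightarrow> 'a \<Rightarrow> bool) \<Rightarrow> nat \<Rightarrow> bool" where
  "has_complete_minor V E n \<longleftrightarrow> (\<exists>B :: nat \<Rightarrow> 'a set.
     (\<forall>i<n. B i \<noteq> {} \<and> B i \<subseteq> V \<and> connected_in E (B i)) \<and>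
     (\<forall>i<n. \<forall>j<n. i \<noteq> j \<longrightarrow> B i \<inter> B j = {}) \<and>
     (\<forall>i<n. \<forall>j<n. i \<noteq> j \<longrightarrow> (\<exists>x\<in>B i. \<exists>y\<in>B j. E x y)))"

end

theory Submission
  imports Defs
begin

text \<open>Let \<open>C\<close> be the hole cover and join every \<open>u \<in> C\<close> to all vertices lying on a hole
  through \<open>u\<close>. The NC property makes the resulting graph chordal: a hole of \<open>G\<close> through \<open>u\<close>
  and a non-neighbour \<open>w\<close> has two sides, and a connected set avoiding \<open>u\<close> and the closed
  neighbourhood of \<open>w\<close> cannot touch both of them, so a new hole at \<open>u\<close> would force an old hole
  through \<open>u\<close> and a vertex that was not joined to \<open>u\<close>. In a clique of the new graph all
  added edges meet a single vertex \<open>u \<in> C\<close>, since otherwise some hole would contain two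
  vertices of \<open>C\<close>. Hence the clique number grows by at most one, and contracting hole sides
  onto \<open>u\<close> turns such a clique into a complete minor of \<open>G\<close>. Finally, \<open>G\<close> is DP-coloured
  greedily along a perfect elimination ordering of the chordal graph.\<close>

section \<open>Connected vertex sets\<close>

abbreviation edges_in :: "('a \<Rightarrow> 'a \<Rightarrow> bool) \<Rightarrow> 'a set \<Rightarrow> ('a \<times> 'a) set" where
  "edges_in E B \<equiv> {(a, b). a \<in> B \<and> b \<in> B \<and> E a b}"

lemma graph_sym: "graph V E \<Longrightarrow> E u v \<Longrightarrow> E v u"
  and graph_irrefl: "graph V E \<Longrightarrow> \<not> E u u"
  and graph_finite: "graph V E \<Longrightarrow> finite V"
  and graph_in1: "graph V E \<Longrightarrow> E u v \<Longrightarrow> u \<in> V"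
  and graph_in2: "graph V E \<Longrightarrow> E u v \<Longrightarrow> v \<in> V"
  by (auto simp: graph_def)

lemma graph_commute: "graph V E \<Longrightarrow> E u v \<longleftrightarrow> E v u"
  by (auto simp: graph_def)

lemma edges_in_rtrancl_mono:
  assumes "(x, y) \<in> (edges_in E A)\<^sup>*" "A \<subseteq> B"
  shows "(x, y) \<in> (edges_in E B)\<^sup>*"
proof -
  have "edges_in E A \<subseteq> edges_in E B" using assms(2) by auto
  then show ?thesis using assms(1) rtrancl_mono by blast
qed

lemma connected_in_singleton: "connected_in E {x}"
  by (simp add: connected_in_def)

text \<open>The relation \<open>edges_in E B\<close> is symmetric, so walks out of the root can be
  reversed and concatenated.\<close>

lemma connected_in_from_root:
  assumes G: "graph V E" and "\<And>x. x \<in> B \<Longrightarrow> (z, x) \<in> (edges_in E B)\<^sup>*"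
  shows "connected_in E B"
proof -
  have "sym (edges_in E B)" using G by (auto simp: sym_def graph_def)
  then have "sym ((edges_in E B)\<^sup>*)" by (rule sym_rtrancl)
  then show ?thesis
    unfolding connected_in_def using assms(2) by (meson rtrancl_trans symD)
qed

lemma connected_in_Un:
  assumes G: "graph V E" and A: "connected_in E A" and B: "connected_in E B"
    and z: "a \<in> A" "b \<in> B" "a = b \<or> E a b"
  shows "connected_in E (A \<union> B)"
proof (rule connected_in_from_root[OF G])
  fix x assume x: "x \<in> A \<union> B"
  have A': "(a, x) \<in> (edges_in E (A \<union> B))\<^sup>*" if "x \<in> A" for x
    using A z(1) that edges_in_rtrancl_mono[where x = a and y = x and A = A and B = "A \<union> B"] by (auto simp: connected_in_def)
  have B': "(b, x) \<in> (edges_in E (A \<union> B))\<^sup>*" if "x \<in> B" for x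
    using B z(2) that edges_in_rtrancl_mono[where x = b and y = x and A = B and B = "A \<union> B"] by (auto simp: connected_in_def)
  have "(a, b) \<in> (edges_in E (A \<union> B))\<^sup>*" using z by auto
  then show "(a, x) \<in> (edges_in E (A \<union> B))\<^sup>*"
    using x A' B' by (meson UnE rtrancl_trans)
qed

lemma connected_in_insert:
  assumes "graph V E" "connected_in E A" "a \<in> A" "E a b"
  shows "connected_in E (insert b A)"
  using connected_in_Un[OF assms(1,2) connected_in_singleton[of E b] assms(3), of b] assms(4) by simp

text \<open>Serves to merge the hole sides chosen for different clique vertices into one branch set.
  Inserting \<open>z\<close> makes a difference only for empty \<open>I\<close>.\<close>

lemma connected_in_UN:
  assumes G: "graph V E" and "\<And>i. i \<in> I \<Longrightarrow> connected_in E (B i)" "\<And>i. i \<in> I \<Longrightarrow> z \<in> B i"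
  shows "connected_in E (insert z (\<Union>i\<in>I. B i))"
proof (rule connected_in_from_root[OF G])
  fix x assume x: "x \<in> insert z (\<Union>i\<in>I. B i)"
  show "(z, x) \<in> (edges_in E (insert z (\<Union>i\<in>I. B i)))\<^sup>*"
  proof (cases "x = z")
    case False
    then obtain i where i: "i \<in> I" "x \<in> B i" using x by auto
    then have "(z, x) \<in> (edges_in E (B i))\<^sup>*" using assms by (auto simp: connected_in_def)
    then show ?thesis by (rule edges_in_rtrancl_mono) (use i in auto)
  qed simp
qed

lemma connected_in_crossing_edge:
  assumes "connected_in E D" "x \<in> D" "x \<in> P" "y \<in> D" "y \<notin> P"
  shows "\<exists>a\<in>D \<inter> P. \<exists>b\<in>D - P. E a b"
proof (rule ccontr)
  assume *: "\<not> ?thesis"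
  have "(x, y) \<in> (edges_in E D)\<^sup>*" using assms by (auto simp: connected_in_def)
  then have "y \<in> P"
    by (induction rule: rtrancl_induct) (use assms(3) * in auto)
  with assms(5) show False by simp
qed

lemma successively_connected:
  assumes G: "graph V E" and "successively E xs"
  shows "connected_in E (set xs)"
  using assms(2)
proof (induction xs)
  case Nil
  then show ?case by (simp add: connected_in_def)
next
  case (Cons x xs)
  show ?case
  proof (cases xs)
    case Nil
    then show ?thesis by (simp add: connected_in_singleton)
  next
    case (Cons y ys)
    then have "E y x" "connected_in E (set xs)" "y \<in> set xs"
      using Cons.prems Cons.IH graph_sym[OF G] by auto
    then show ?thesis using connected_in_insert[OF G] by simp
  qed
qed

section \<open>Induced paths and holes\<close>

definition induced_path :: "('a \<Rightarrow> 'a \<Rightarrow> bool) \<Rightarrow> 'a list \<Rightarrow> bool" where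
  "induced_path E ps \<longleftrightarrow> distinct ps \<and>
     (\<forall>i<length ps. \<forall>j<length ps. E (ps ! i) (ps ! j) \<longleftrightarrow> j = Suc i \<or> i = Suc j)"

lemma induced_path_successively: "induced_path E ps \<Longrightarrow> successively E ps"
  by (simp add: induced_path_def successively_conv_nth)

lemma induced_path_rev:
  assumes "induced_path E ps"
  shows "induced_path E (rev ps)"
  unfolding induced_path_def
proof (intro conjI allI impI)
  show "distinct (rev ps)" using assms by (simp add: induced_path_def)
next
  fix i j assume ij: "i < length (rev ps)" "j < length (rev ps)"
  let ?n = "length ps"
  have "E (ps ! (?n - Suc i)) (ps ! (?n - Suc j)) \<longleftrightarrow>
      ?n - Suc j = Suc (?n - Suc i) \<or> ?n - Suc i = Suc (?n - Suc j)"
    using assms ij by (simp add: induced_path_def)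
  also have "\<dots> \<longleftrightarrow> j = Suc i \<or> i = Suc j" using ij by auto
  finally show "E (rev ps ! i) (rev ps ! j) \<longleftrightarrow> j = Suc i \<or> i = Suc j"
    using ij by (simp add: rev_nth)
qed

text \<open>All claims are read off from positions: \<open>w\<close> has index
  \<open>length as\<close>, and distinctness turns equations between indices into equations between
  vertices. Besides cutting holes, this peels the first vertices off a path by taking
  \<open>as\<close> empty or a singleton.\<close>

lemma induced_path_split:
  assumes "induced_path E (as @ w # bs)"
  shows "successively E as" "successively E bs"
    "w \<notin> set as" "w \<notin> set bs" "set as \<inter> set bs = {}"
    "\<And>x. x \<in> set as \<Longrightarrow> E w x \<longleftrightarrow> x = last as"
    "\<And>x. x \<in> set bs \<Longrightarrow> E w x \<longleftrightarrow> x = hd bs"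
    "\<And>x y. x \<in> set as \<Longrightarrow> y \<in> set bs \<Longrightarrow> \<not> E x y"
proof -
  let ?ps = "as @ w # bs" and ?m = "length as"
  have d: "distinct ?ps" using assms by (simp add: induced_path_def)
  have E: "E (?ps ! i) (?ps ! j) \<longleftrightarrow> j = Suc i \<or> i = Suc j"
    if "i < length ?ps" "j < length ?ps" for i j
    using assms that unfolding induced_path_def by blast
  show "successively E as" "successively E bs"
    using induced_path_successively[OF assms] by (auto simp: successively_append_iff successively_Cons)
  show "w \<notin> set as" "w \<notin> set bs" "set as \<inter> set bs = {}" using d by auto
  show "E w x \<longleftrightarrow> x = last as" if x: "x \<in> set as" for x
  proof -
    obtain i where i: "i < ?m" "x = as ! i" using x by (auto simp: in_set_conv_nth)
    have "E w x \<longleftrightarrow> ?m = Suc i"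
      using E[of ?m i] i by (simp add: nth_append)
    also have "\<dots> \<longleftrightarrow> i = ?m - 1" using i by auto
    also have "\<dots> \<longleftrightarrow> as ! i = as ! (?m - 1)"
      using d i by (intro nth_eq_iff_index_eq[symmetric]) auto
    finally show ?thesis using i x by (metis last_conv_nth length_pos_if_in_set less_nat_zero_code list.size(3))
  qed
  show "E w x \<longleftrightarrow> x = hd bs" if x: "x \<in> set bs" for x
  proof -
    obtain i where i: "i < length bs" "x = bs ! i" using x by (auto simp: in_set_conv_nth)
    have "E w x \<longleftrightarrow> i = 0"
      using E[of ?m "?m + Suc i"] i by (simp add: nth_append)
    also have "\<dots> \<longleftrightarrow> bs ! i = bs ! 0"
      using d i by (intro nth_eq_iff_index_eq[symmetric]) auto
    finally show ?thesis using i x by (metis hd_conv_nth length_pos_if_in_set less_nat_zero_code list.size(3))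
  qed
  show "\<not> E x y" if xy: "x \<in> set as" "y \<in> set bs" for x y
  proof -
    obtain i where i: "i < ?m" "x = as ! i" using xy by (auto simp: in_set_conv_nth)
    obtain j where j: "j < length bs" "y = bs ! j" using xy by (auto simp: in_set_conv_nth)
    show ?thesis using E[of i "?m + Suc j"] i j by (simp add: nth_append)
  qed
qed

lemma hole_subset: "H \<in> holes V E \<Longrightarrow> H \<subseteq> V"
  by (auto simp: holes_def is_hole_def)

lemma is_hole_cong:
  assumes "\<And>x y. x \<in> H \<Longrightarrow> y \<in> H \<Longrightarrow> E x y \<longleftrightarrow> F x y" "is_hole V E H"
  shows "is_hole V F H"
proof -
  obtain cs where cs: "distinct cs" "length cs \<ge> 4" "set cs = H" "H \<subseteq> V"
     "\<forall>i<length cs. \<forall>j<length cs.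
        E (cs!i) (cs!j) \<longleftrightarrow> (j = Suc i mod length cs \<or> i = Suc j mod length cs)"
    using assms(2) unfolding is_hole_def by blast
  have "F (cs ! i) (cs ! j) \<longleftrightarrow> E (cs ! i) (cs ! j)" if "i < length cs" "j < length cs" for i j
    using assms(1) cs(3) that nth_mem by blast
  then show ?thesis unfolding is_hole_def using cs by (intro exI[of _ cs]) auto
qed

text \<open>Rotation preserves the cyclic successor relation, so a hole can be listed starting from
  any of its vertices.\<close>

lemma Suc_mod_rotate:
  assumes "i < n" "j < (n::nat)"
  shows "(k + j) mod n = Suc ((k + i) mod n) mod n \<longleftrightarrow> j = Suc i mod n"
proof -
  define m where "m = k mod n"
  have m: "m < n" using assms by (simp add: m_def)
  have red: "(k + l) mod n = (if m + l < n then m + l else m + l - n)" if "l < n" for l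
  proof -
    have "(k + l) mod n = (m + l) mod n" by (simp add: m_def mod_add_left_eq)
    then show ?thesis using m that by (simp add: mod_if)
  qed
  show ?thesis unfolding red[OF assms(1)] red[OF assms(2)] using assms m by (auto simp: mod_Suc)
qed

lemma Suc_mod_Suc: "l \<le> n \<Longrightarrow> Suc l mod Suc n = (if l = n then 0 else Suc l)"
  by simp

text \<open>Cutting the cyclic list open at \<open>u\<close> turns the modular adjacency condition
  into the linear one of an induced path.\<close>

lemma hole_obtain_path:
  assumes G: "graph V E" and H: "H \<in> holes V E" and u: "u \<in> H"
  obtains ps where "induced_path E ps" "length ps \<ge> 3" "u \<notin> set ps" "H = insert u (set ps)"
    "\<And>v. v \<in> set ps \<Longrightarrow> E u v \<longleftrightarrow> v = hd ps \<or> v = last ps"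
proof -
  obtain cs where cs: "distinct cs" "length cs \<ge> 4" "set cs = H"
     "\<And>i j. i < length cs \<Longrightarrow> j < length cs \<Longrightarrow>
        E (cs!i) (cs!j) \<longleftrightarrow> (j = Suc i mod length cs \<or> i = Suc j mod length cs)"
    using H unfolding holes_def is_hole_def by blast
  let ?n = "length cs"
  obtain k where k: "k < ?n" "u = cs ! k" using u cs(3) by (auto simp: in_set_conv_nth)
  have n0: "0 < ?n" using k by linarith
  let ?ds = "rotate k cs"
  have nth: "?ds ! i = cs ! ((k + i) mod ?n)" if "i < ?n" for i
    using that by (simp add: nth_rotate add.commute)
  have E: "E (?ds ! i) (?ds ! j) \<longleftrightarrow> j = Suc i mod ?n \<or> i = Suc j mod ?n"
    if ij: "i < ?n" "j < ?n" for i j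
  proof -
    have "E (?ds ! i) (?ds ! j) \<longleftrightarrow> (k + j) mod ?n = Suc ((k + i) mod ?n) mod ?n \<or>
        (k + i) mod ?n = Suc ((k + j) mod ?n) mod ?n"
      using ij cs(4)[OF mod_less_divisor[OF n0] mod_less_divisor[OF n0], of "k + i" "k + j"]
      by (simp add: nth)
    then show ?thesis using ij by (simp add: Suc_mod_rotate)
  qed
  obtain d ps where dps: "?ds = d # ps" using cs(2) by (cases ?ds) auto
  have "?ds ! 0 = u" using nth[OF n0] k by simp
  then have du: "?ds = u # ps" using dps by simp
  have len: "?n = Suc (length ps)" using du by (metis length_Cons length_rotate)
  have dist: "distinct (u # ps)" using cs(1) du by (metis distinct_rotate)
  have E': "E ((u # ps) ! i) ((u # ps) ! j) \<longleftrightarrow>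
      j = Suc i mod Suc (length ps) \<or> i = Suc j mod Suc (length ps)"
    if "i < Suc (length ps)" "j < Suc (length ps)" for i j
    using E[of i j] that len du by simp
  have ind: "induced_path E ps"
    unfolding induced_path_def
  proof (intro conjI allI impI)
    show "distinct ps" using dist by simp
    fix i j assume ij: "i < length ps" "j < length ps"
    then have "E (ps ! i) (ps ! j) \<longleftrightarrow>
        Suc j = Suc (Suc i) mod Suc (length ps) \<or> Suc i = Suc (Suc j) mod Suc (length ps)"
      using E'[of "Suc i" "Suc j"] by simp
    also have "\<dots> \<longleftrightarrow> j = Suc i \<or> i = Suc j"
      using ij by (subst (1 2) Suc_mod_Suc) auto
    finally show "E (ps ! i) (ps ! j) \<longleftrightarrow> j = Suc i \<or> i = Suc j" .
  qed
  have len3: "length ps \<ge> 3" using cs(2) len by simp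
  have H': "H = insert u (set ps)" using cs(3) du by (metis list.simps(15) set_rotate)
  have "E u v \<longleftrightarrow> v = hd ps \<or> v = last ps" if v: "v \<in> set ps" for v
  proof -
    obtain j where j: "j < length ps" "v = ps ! j" using v by (auto simp: in_set_conv_nth)
    have "E u v \<longleftrightarrow> Suc j = Suc 0 mod Suc (length ps) \<or> 0 = Suc (Suc j) mod Suc (length ps)"
      using E'[of 0 "Suc j"] j by simp
    \<comment> \<open>The vertex \<open>u\<close> has cyclic index 0, so position \<open>j\<close>
      of \<open>ps\<close> has cyclic index \<open>Suc j\<close>; the second equation is the
      wrap-around at the last vertex.\<close>
    also have "\<dots> \<longleftrightarrow> j = 0 \<or> j = length ps - 1"
      using j len3 by (subst (1 2) Suc_mod_Suc) auto
    also have "\<dots> \<longleftrightarrow> ps ! j = ps ! 0 \<or> ps ! j = ps ! (length ps - 1)"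
    proof -
      have "0 < length ps" "length ps - 1 < length ps" "distinct ps" using dist len3 by auto
      then show ?thesis using nth_eq_iff_index_eq j(1) by metis
    qed
    finally show ?thesis
      using j len3 by (metis hd_conv_nth last_conv_nth list.size(3) not_numeral_le_zero)
  qed
  then show thesis using that ind len3 dist H' by auto
qed

text \<open>Converse of opening a hole at \<open>u\<close>. At least three path vertices are
  required because a hole has length at least 4.\<close>

lemma hole_from_path:
  assumes G: "graph V E" and ps: "induced_path E ps" and len: "length ps \<ge> 3"
    and u: "u \<notin> set ps" "insert u (set ps) \<subseteq> V"
    and Eu: "\<And>v. v \<in> set ps \<Longrightarrow> E u v \<longleftrightarrow> v = hd ps \<or> v = last ps"
  shows "insert u (set ps) \<in> holes V E"
proof -
  let ?n = "length (u # ps)"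
  have dist: "distinct ps" using ps by (simp add: induced_path_def)
  have Eu': "E u (ps ! j) \<longleftrightarrow> j = 0 \<or> j = length ps - 1" if j: "j < length ps" for j
  proof -
    have "E u (ps ! j) \<longleftrightarrow> ps ! j = ps ! 0 \<or> ps ! j = ps ! (length ps - 1)"
      using Eu[of "ps ! j"] j len by (metis hd_conv_nth last_conv_nth list.size(3) not_numeral_le_zero nth_mem)
    moreover have "0 < length ps" "length ps - 1 < length ps" using len by auto
    ultimately show ?thesis using nth_eq_iff_index_eq dist j by metis
  qed
  have "E ((u # ps) ! i) ((u # ps) ! j) \<longleftrightarrow> j = Suc i mod ?n \<or> i = Suc j mod ?n"
    if ij: "i < ?n" "j < ?n" for i j
  proof (cases i)
    case 0
    show ?thesis
    proof (cases j)
      case 0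
      then show ?thesis using \<open>i = 0\<close> graph_irrefl[OF G] len by (auto simp: mod_Suc)
    next
      case (Suc j')
      then show ?thesis using \<open>i = 0\<close> Eu'[of j'] ij len by (auto simp: mod_Suc)
    qed
  next
    case (Suc i')
    show ?thesis
    proof (cases j)
      case 0
      then show ?thesis using Suc Eu'[of i'] ij len graph_commute[OF G] by (auto simp: mod_Suc)
    next
      case (Suc j')
      then show ?thesis using \<open>i = Suc i'\<close> ps ij unfolding induced_path_def by (auto simp: mod_Suc)
    qed
  qed
  then show ?thesis
    unfolding holes_def is_hole_def using u dist len by (intro CollectI exI[of _ "u # ps"]) auto
qed

lemma connected_in_obtain_walk:
  assumes "connected_in E D" "x \<in> D" "y \<in> D"
  shows "\<exists>ps. ps \<noteq> [] \<and> hd ps = x \<and> last ps = y \<and> set ps \<subseteq> D \<and> successively E ps"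
proof -
  have "(x, y) \<in> (edges_in E D)\<^sup>*" using assms by (auto simp: connected_in_def)
  then show ?thesis
  proof (induction rule: rtrancl_induct)
    case base
    then show ?case using assms(2) by (intro exI[of _ "[x]"]) auto
  next
    case (step y z)
    then obtain ps where "ps \<noteq> []" "hd ps = x" "last ps = y" "set ps \<subseteq> D" "successively E ps" by blast
    then show ?case using step(2) by (intro exI[of _ "ps @ [z]"]) (auto simp: successively_append_iff)
  qed
qed

text \<open>The path is a walk of least length from \<open>x\<close> to \<open>y\<close> inside
  \<open>D\<close>.\<close>

lemma connected_in_obtain_induced_path:
  assumes G: "graph V E" and D: "connected_in E D" "x \<in> D" "y \<in> D"
  obtains ps where "induced_path E ps" "ps \<noteq> []" "hd ps = x" "last ps = y" "set ps \<subseteq> D"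
proof -
  define P where "P ps \<longleftrightarrow> ps \<noteq> [] \<and> hd ps = x \<and> last ps = y \<and> set ps \<subseteq> D \<and> successively E ps" for ps
  obtain ps where ps: "P ps" and min: "\<And>qs. P qs \<Longrightarrow> length ps \<le> length qs"
    using connected_in_obtain_walk[OF D] ex_has_least_nat[of P _ length] unfolding P_def by metis
  \<comment> \<open>A repetition or a chord would allow a shortcut.\<close>
  have cut: "\<not> E (ps ! i) (ps ! j)" if "Suc i < j" "j < length ps" for i j
  proof
    assume e: "E (ps ! i) (ps ! j)"
    let ?qs = "take (Suc i) ps @ drop j ps"
    have "last (take (Suc i) ps) = ps ! i" "hd (drop j ps) = ps ! j"
      using that by (auto simp: take_Suc_conv_app_nth hd_drop_conv_nth)
    moreover have "successively E (take (Suc i) ps)" "successively E (drop j ps)"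
      using ps unfolding P_def
      by (metis append_take_drop_id successively_append_iff)+
    moreover have "take (Suc i) ps \<noteq> []" "drop j ps \<noteq> []" using that by auto
    moreover have "set ?qs \<subseteq> set ps" by (auto dest: in_set_takeD in_set_dropD)
    ultimately have "P ?qs" using ps e that unfolding P_def
      by (auto simp: successively_append_iff hd_take)
    then show False using min[of ?qs] that by simp
  qed
  have cut2: "ps ! i \<noteq> ps ! j" if "i < j" "j < length ps" for i j
  proof
    assume e: "ps ! i = ps ! j"
    let ?qs = "take (Suc i) ps @ drop (Suc j) ps"
    have l: "last (take (Suc i) ps) = ps ! j"
      using that e by (auto simp: take_Suc_conv_app_nth)
    have s: "successively E (take (Suc i) ps)" "successively E (drop (Suc j) ps)"
      using ps unfolding P_def
      by (metis append_take_drop_id successively_append_iff)+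
    have n: "take (Suc i) ps \<noteq> []" using that by auto
    have sub: "set ?qs \<subseteq> set ps" by (auto dest: in_set_takeD in_set_dropD)
    have "P ?qs"
    proof (cases "Suc j < length ps")
      case True
      then have "E (ps ! j) (hd (drop (Suc j) ps))"
        using ps by (simp add: P_def successively_conv_nth hd_drop_conv_nth)
      then show ?thesis using ps True l s n sub that unfolding P_def
        by (auto simp: successively_append_iff hd_take)
    next
      \<comment> \<open>Here \<open>j\<close> is the last index and the dropped part is empty; the
        shortened walk still ends in \<open>y\<close> because
        \<open>ps ! i = ps ! j\<close>.\<close>
      case False
      then have "ps ! j = y" using ps that(2)
        by (metis P_def Suc_lessI diff_Suc_1 last_conv_nth)
      then show ?thesis using ps False l s n sub that unfolding P_def
        by (auto simp: hd_take)
    qed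
    then show False using min[of ?qs] that by simp
  qed
  have "induced_path E ps"
    unfolding induced_path_def
  proof (intro conjI allI impI)
    show "distinct ps" using cut2 by (metis distinct_conv_nth nat_neq_iff)
    fix i j assume ij: "i < length ps" "j < length ps"
    have s: "E (ps ! i) (ps ! Suc i)" if "Suc i < length ps" for i
      using ps that by (simp add: P_def successively_conv_nth)
    consider "i = j" | "j = Suc i" | "i = Suc j" | "Suc i < j" | "Suc j < i" by linarith
    then show "E (ps ! i) (ps ! j) \<longleftrightarrow> j = Suc i \<or> i = Suc j"
    proof cases
      case 1 then show ?thesis using graph_irrefl[OF G] by simp
    next
      case 2 then show ?thesis using s ij by simp
    next
      case 3 then show ?thesis using s ij graph_commute[OF G] by metis
    next
      case 4 then show ?thesis using cut ij by auto
    next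
      case 5 then show ?thesis using cut ij graph_commute[OF G, of "ps ! i"] by auto
    qed
  qed
  then show thesis using that ps unfolding P_def by blast
qed

text \<open>The main device for producing holes. An induced path in \<open>D\<close> from
  \<open>x\<close> to \<open>z\<close> has an inner vertex since its ends are distinct and
  nonadjacent, and \<open>y\<close> sees only its ends, so \<open>y\<close> closes it to a hole. The
  connectedness of \<open>H - {y}\<close> allows a later argument to find out which parts of
  \<open>D\<close> the path crosses.\<close>

lemma hole_from_connected:
  assumes G: "graph V E" and D: "connected_in E D" "D \<subseteq> V" "y \<notin> D"
    and xz: "x \<in> D" "z \<in> D" "x \<noteq> z" "\<not> E x z" "E y x" "E y z"
    and N: "\<And>v. v \<in> D \<Longrightarrow> E y v \<Longrightarrow> v = x \<or> v = z"
  obtains H where "H \<in> holes V E" "{x, y, z} \<subseteq> H" "H \<subseteq> insert y D" "connected_in E (H - {y})"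
proof -
  obtain ps where ps: "induced_path E ps" "ps \<noteq> []" "hd ps = x" "last ps = z" "set ps \<subseteq> D"
    using connected_in_obtain_induced_path[OF G D(1) xz(1,2)] .
  have len: "length ps \<ge> 3"
  proof (rule ccontr)
    assume "\<not> ?thesis"
    then consider a where "ps = [a]" | a b where "ps = [a, b]"
      using ps(2) by (cases ps; cases "tl ps"; cases "tl (tl ps)") auto
    then show False
      using ps(3,4) xz(3,4) induced_path_successively[OF ps(1)] by cases auto
  qed
  have xs: "x \<in> set ps" "z \<in> set ps" using ps by auto
  have "insert y (set ps) \<in> holes V E"
    by (rule hole_from_path[OF G ps(1) len]) (use ps D xz N graph_in1[OF G] in auto)
  moreover have "insert y (set ps) - {y} = set ps" using ps(5) D(3) by auto
  ultimately show thesis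
    using that[of "insert y (set ps)"] xs ps(5)
      successively_connected[OF G induced_path_successively[OF ps(1)]] by auto
qed

text \<open>Opening the hole at \<open>u\<close> and splitting the path at \<open>w\<close> gives
  the two arcs between them. An arc may be a single vertex, in which case its neighbours of
  \<open>u\<close> and of \<open>w\<close> coincide.\<close>

lemma hole_two_sides:
  assumes G: "graph V E" and H: "H \<in> holes V E" and uw: "u \<in> H" "w \<in> H" "u \<noteq> w" "\<not> E u w"
  obtains A B a b c d where "H = {u, w} \<union> A \<union> B" "u \<notin> A" "u \<notin> B" "w \<notin> A" "w \<notin> B" "A \<inter> B = {}"
    "connected_in E A" "connected_in E B"
    "{v \<in> A. E u v} = {a}" "{v \<in> B. E u v} = {b}"
    "{v \<in> A. E w v} = {c}" "{v \<in> B. E w v} = {d}"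
    "\<forall>x\<in>A. \<forall>y\<in>B. \<not> E x y"
proof -
  obtain ps where ps: "induced_path E ps" "length ps \<ge> 3" "u \<notin> set ps" "H = insert u (set ps)"
    "\<And>v. v \<in> set ps \<Longrightarrow> E u v \<longleftrightarrow> v = hd ps \<or> v = last ps"
    using hole_obtain_path[OF G H uw(1)] by metis
  have "w \<in> set ps" using uw ps(4) by auto
  then obtain as bs where sp: "ps = as @ w # bs" by (meson split_list)
  \<comment> \<open>An empty piece would make \<open>w\<close> an end of the path and hence a
    neighbour of \<open>u\<close>.\<close>
  have as: "as \<noteq> []" and bs: "bs \<noteq> []" using ps(5)[of w] uw(4) sp by auto
  note s = induced_path_split[OF ps(1)[unfolded sp]]
  have dist: "distinct ps" using ps(1) by (simp add: induced_path_def)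
  have hl: "hd ps = hd as" "last ps = last bs" using sp as bs by auto
  have "hd as \<in> set as" "last as \<in> set as" "hd bs \<in> set bs" "last bs \<in> set bs" using as bs by auto
  then show thesis
    using ps s dist sp uw hl
    by (intro that[of "set as" "set bs" "hd as" "last bs" "last as" "hd bs"] successively_connected[OF G])
      auto
qed

section \<open>Holes through an NC vertex\<close>

text \<open>If \<open>X\<close> touched both sides of \<open>H\<close>, then a hole avoiding \<open>u\<close> would share with \<open>H\<close>
  the two edges at \<open>w\<close>.\<close>

lemma NC_vertex_free_side:
  assumes G: "graph V E" and NC: "NC_vertex V E u"
    and H: "H \<in> holes V E" "u \<in> H" "w \<in> H" "u \<noteq> w" "\<not> E u w"
    and X: "connected_in E X" "X \<subseteq> V" "u \<notin> X" "w \<notin> X" "\<And>x. x \<in> X \<Longrightarrow> \<not> E w x"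
  obtains A a c where "A \<subseteq> H" "connected_in E A" "u \<notin> A" "w \<notin> A"
    "{v \<in> A. E u v} = {a}" "{v \<in> A. E w v} = {c}"
    "X \<inter> A = {}" "\<forall>x\<in>X. \<forall>v\<in>A. \<not> E x v"
proof -
  obtain A B a b c d where s: "H = {u, w} \<union> A \<union> B" "u \<notin> A" "u \<notin> B" "w \<notin> A" "w \<notin> B" "A \<inter> B = {}"
    and con: "connected_in E A" "connected_in E B"
    and n: "{v \<in> A. E u v} = {a}" "{v \<in> B. E u v} = {b}"
      "{v \<in> A. E w v} = {c}" "{v \<in> B. E w v} = {d}"
    and AB: "\<forall>x\<in>A. \<forall>y\<in>B. \<not> E x y"
    using hole_two_sides[OF G H] .
  have HV: "H \<subseteq> V" using hole_subset[OF H(1)] .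
  have cd: "c \<in> A" "E w c" "d \<in> B" "E w d" using n(3,4) by auto
  \<comment> \<open>Touching means meeting or being adjacent, so its failure yields both of the
    final conclusions about \<open>X\<close> and the side.\<close>
  define touch where "touch S \<longleftrightarrow> (\<exists>x\<in>X. \<exists>v\<in>S. x = v \<or> E x v)" for S
  have "\<not> (touch A \<and> touch B)"
  proof
    assume t: "touch A \<and> touch B"
    then obtain x1 v1 where 1: "x1 \<in> X" "v1 \<in> A" "x1 = v1 \<or> E x1 v1" unfolding touch_def by blast
    obtain x2 v2 where 2: "x2 \<in> X" "v2 \<in> B" "x2 = v2 \<or> E x2 v2" using t unfolding touch_def by blast
    have "connected_in E ((X \<union> A) \<union> B)"
      using connected_in_Un[OF G connected_in_Un[OF G X(1) con(1) 1] con(2) _ 2(2,3)] 2(1) by blast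
    \<comment> \<open>Since \<open>X\<close> avoids the closed neighbourhood of \<open>w\<close>,
      the only neighbours of \<open>w\<close> in the union are \<open>c\<close> and
      \<open>d\<close>. The union also misses \<open>u\<close>, hence so does the hole.\<close>
    then obtain H' where H': "H' \<in> holes V E" "{c, w, d} \<subseteq> H'" "H' \<subseteq> insert w ((X \<union> A) \<union> B)"
    proof (rule hole_from_connected[OF G, where y = w and x = c and z = d])
      show "X \<union> A \<union> B \<subseteq> V" using X(2) s(1) HV by auto
      show "w \<notin> X \<union> A \<union> B" using X(4) s(4,5) by auto
      show "c \<noteq> d" "\<not> E c d" using cd s(6) AB by auto
      show "v = c \<or> v = d" if "v \<in> X \<union> A \<union> B" "E w v" for v using that X(5) n(3,4) by auto
    qed (use cd that in auto)
    have "u \<notin> H'" using H'(3) X s H(4) by auto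
    moreover have "share_consecutive_edges E H H'"
      unfolding share_consecutive_edges_def using cd H' s graph_sym[OF G cd(2)]
      by (intro exI[of _ c] exI[of _ w] exI[of _ d]) auto
    ultimately show False using NC H H'(1) unfolding NC_vertex_def holes_at_def by blast
  qed
  then consider "\<not> touch A" | "\<not> touch B" by blast
  then show thesis
  proof cases
    case 1
    then show thesis using that[of A a c] s con n unfolding touch_def by auto
  next
    case 2
    then show thesis using that[of B b d] s con n unfolding touch_def by auto
  qed
qed

text \<open>A side \<open>A\<close> of \<open>H\<close> untouched by \<open>X\<close> leads from
  \<open>u\<close> to \<open>x\<close>, and \<open>X\<close> leads from \<open>q\<close> back to
  \<open>u\<close>. The only neighbours of \<open>u\<close> along this route are \<open>y\<close>
  and \<open>a\<close>, so the route contains a hole through \<open>u\<close>, and this hole has to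
  use \<open>q\<close>. In the application \<open>q\<close> is the second vertex of a supposed new
  hole opened at \<open>u\<close>.\<close>

lemma NC_vertex_hole_through:
  assumes G: "graph V E" and NC: "NC_vertex V E u"
    and H: "H \<in> holes V E" "u \<in> H" "x \<in> H" "u \<noteq> x" "\<not> E u x"
    and q: "E x q" "q \<noteq> u" "\<not> E u q" "t \<in> X" "E q t"
    and X: "connected_in E X" "X \<subseteq> V" "u \<notin> X" "x \<notin> X" "\<And>v. v \<in> X \<Longrightarrow> \<not> E x v"
      "{v \<in> X. E u v} = {y}"
  shows "\<exists>H'\<in>holes V E. u \<in> H' \<and> q \<in> H'"
proof -
  obtain A a c where A: "A \<subseteq> H" "connected_in E A" "u \<notin> A" "x \<notin> A"
    "{v \<in> A. E u v} = {a}" "{v \<in> A. E x v} = {c}"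
    "X \<inter> A = {}" "\<forall>v\<in>X. \<forall>w\<in>A. \<not> E v w"
    using NC_vertex_free_side[OF G NC H X(1-5)] .
  have HV: "H \<subseteq> V" using hole_subset[OF H(1)] .
  have c: "c \<in> A" "E c x" using A(6) graph_sym[OF G] by auto
  have y: "y \<in> X" "E u y" and a: "a \<in> A" "E u a" using X(6) A(5) by auto
  let ?D1 = "insert x A" and ?D2 = "insert q X"
  have "connected_in E ?D1" using connected_in_insert[OF G A(2) c] .
  moreover have "connected_in E ?D2" using connected_in_insert[OF G X(1) q(4) graph_sym[OF G q(5)]] .
  ultimately have D: "connected_in E (?D1 \<union> ?D2)"
    using connected_in_Un[OF G, of ?D1 ?D2 x q] q(1) by blast
  have "x \<in> V" "q \<in> V" using q(1) graph_in1[OF G] graph_in2[OF G] by auto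
  then have DV: "?D1 \<union> ?D2 \<subseteq> V" using A(1) HV X(2) by blast
  obtain H' where H': "H' \<in> holes V E" "{y, u, a} \<subseteq> H'" "H' \<subseteq> insert u (?D1 \<union> ?D2)"
      "connected_in E (H' - {u})"
  proof (rule hole_from_connected[OF G D DV, where y = u and x = y and z = a])
    show "u \<notin> ?D1 \<union> ?D2" using H(4) q(2) A(3) X(3) by auto
    show "y \<in> ?D1 \<union> ?D2" "a \<in> ?D1 \<union> ?D2" "y \<noteq> a" "\<not> E y a" "E u y" "E u a"
      using y a A(7,8) by auto
    show "v = y \<or> v = a" if "v \<in> ?D1 \<union> ?D2" "E u v" for v
      using that H(5) q(3) A(5) X(6) by blast
  qed (rule that)
  \<comment> \<open>Without \<open>q\<close>, the connected set \<open>H' - {u}\<close> would need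
    an edge between \<open>X\<close> and \<open>insert x A\<close>, and there is none.\<close>
  have "q \<in> H'"
  proof (rule ccontr)
    assume qH: "q \<notin> H'"
    have "y \<in> H' - {u}" "a \<in> H' - {u}" "a \<notin> X"
      using H'(2) y a A(7) X(3) A(3) by auto
    then obtain v w where vw: "v \<in> (H' - {u}) \<inter> X" "w \<in> (H' - {u}) - X" "E v w"
      using connected_in_crossing_edge[OF H'(4), of y X a] y by blast
    then have "w = x \<or> w \<in> A" using H'(3) qH by auto
    then show False using vw X(5) A(8) graph_sym[OF G vw(3)] by blast
  qed
  then show ?thesis using H' by blast
qed

section \<open>The chordal fill-in\<close>

text \<open>The set \<open>C\<close> is a parameter because chordality is proved by adding the
  vertices of the cover one at a time.\<close>

definition fillin :: "'a set \<Rightarrow> ('a \<Rightarrow> 'a \<Rightarrow> bool) \<Rightarrow> 'a set \<Rightarrow> 'a \<Rightarrow> 'a \<Rightarrow> bool" where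
  "fillin V E C x y \<longleftrightarrow> E x y \<or> x \<noteq> y \<and> (x \<in> C \<or> y \<in> C) \<and> (\<exists>H\<in>holes V E. x \<in> H \<and> y \<in> H)"

lemma graph_fillin: "graph V E \<Longrightarrow> graph V (fillin V E C)"
  using hole_subset unfolding graph_def fillin_def by blast

lemma fillin_other: "x \<notin> C \<Longrightarrow> y \<notin> C \<Longrightarrow> fillin V E C x y \<longleftrightarrow> E x y"
  by (auto simp: fillin_def)

text \<open>Holes avoiding \<open>u\<close> see no added edge. A hole of the fill-in through
  \<open>u\<close> is opened at \<open>u\<close>: if an end of the path is joined to
  \<open>u\<close> only by an added edge, the vertex next to it is shown to lie on an old hole with
  \<open>u\<close>; otherwise the hole itself is old. Either way \<open>u\<close> is joined to an
  inner vertex of the path, which is impossible.\<close>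

lemma holes_fillin_vertex:
  assumes G: "graph V E" and NC: "NC_vertex V E u"
  shows "holes V (fillin V E {u}) = {H \<in> holes V E. u \<notin> H}"
proof -
  let ?F = "fillin V E {u}"
  have GF: "graph V ?F" using graph_fillin[OF G] .
  have avoid: "H \<in> holes V ?F \<longleftrightarrow> H \<in> holes V E" if "u \<notin> H" for H
  proof -
    have "?F x y \<longleftrightarrow> E x y" if "x \<in> H" "y \<in> H" for x y
      using that \<open>u \<notin> H\<close> by (intro fillin_other) auto
    then show ?thesis using is_hole_cong[of H E ?F V] is_hole_cong[of H ?F E V] by (auto simp: holes_def)
  qed
  \<comment> \<open>Excludes a first vertex joined to \<open>u\<close> only in the fill-in; the last
    vertex is handled by reversing the path.\<close>
  have no_path: False
    if ps: "induced_path ?F ps" "length ps \<ge> 3" "u \<notin> set ps"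
      "\<And>v. v \<in> set ps \<Longrightarrow> ?F u v \<longleftrightarrow> v = hd ps \<or> v = last ps"
      and psV: "set ps \<subseteq> V" and x: "\<not> E u (hd ps)" for ps
  proof -
    obtain x q rs where sp: "ps = x # q # rs" "rs \<noteq> []"
      using ps(2) by (cases ps; cases "tl ps"; cases "tl (tl ps)") auto
    let ?y = "last rs"
    have EF: "?F v w \<longleftrightarrow> E v w" if "v \<in> set ps" "w \<in> set ps" for v w
      using that ps(3) by (intro fillin_other) auto
    note ips = induced_path_split[of ?F "[x]" q rs] and ips' = induced_path_split[of ?F "[]" x "q # rs"]
    have psF: "induced_path ?F ([x] @ q # rs)" "induced_path ?F ([] @ x # q # rs)"
      using ps(1) sp by auto
    have s: "successively ?F rs" "q \<notin> set rs" "x \<notin> set rs" "x \<noteq> q"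
      using ips[OF psF(1)] ips'[OF psF(2)] by auto
    have s5: "?F q v \<longleftrightarrow> v = hd rs" if "v \<in> set rs" for v using ips(7)[OF psF(1) that] .
    have s6: "\<not> ?F x v" if "v \<in> set rs" for v using ips(8)[OF psF(1) _ that] by simp
    have s7: "?F x q" using ips'(7)[OF psF(2), of q] by simp
    have Fu: "?F u x" "\<not> ?F u q" "\<And>v. v \<in> set rs \<Longrightarrow> ?F u v \<longleftrightarrow> v = ?y"
    proof -
      have hl: "hd ps = x" "last ps = ?y" using sp by auto
      show "?F u x" using ps(4)[of x] sp hl by simp
      have "q \<noteq> ?y" using s(2) sp(2) last_in_set by metis
      then show "\<not> ?F u q" using ps(4)[of q] sp(1) s(4) unfolding hl by simp
      show "?F u v \<longleftrightarrow> v = ?y" if "v \<in> set rs" for v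
      proof -
        have "v \<noteq> x" using s(3) that by blast
        then show ?thesis using ps(4)[of v] sp(1) that unfolding hl by simp
      qed
    qed
    have "successively E rs" using s(1) EF sp by (simp add: successively_conv_nth)
    then have X: "connected_in E (set rs)" using successively_connected[OF G] by blast
    have rsV: "set rs \<subseteq> V" using psV sp by auto
    obtain H where H: "H \<in> holes V E" "u \<in> H" "x \<in> H"
      using Fu(1) x sp by (auto simp: fillin_def)
    have ux: "u \<noteq> x" "\<not> E u x" using x ps(3) sp by auto
    have q: "E x q" "q \<noteq> u" "\<not> E u q" "hd rs \<in> set rs" "E q (hd rs)"
      using s5[of "hd rs"] s7 EF sp ps(3) Fu(2) by (auto simp: fillin_def)
    have "\<exists>H\<in>holes V E. u \<in> H \<and> q \<in> H"
    proof (cases "E u ?y")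
      \<comment> \<open>The rest \<open>rs\<close> of the path already returns to \<open>u\<close>
        along an edge of the original graph.\<close>
      case True
      show ?thesis
      proof (rule NC_vertex_hole_through[OF G NC H ux q X rsV])
        show "u \<notin> set rs" "x \<notin> set rs" using ps(3) sp s(3) by auto
        show "\<not> E x v" if "v \<in> set rs" for v using s6[OF that] by (simp add: fillin_def)
        show "{v \<in> set rs. E u v} = {?y}" using Fu(3) True sp(2) by (auto simp: fillin_def)
      qed
    next
      \<comment> \<open>The last edge is also an added one. The route is prolonged by a side of a
        hole through \<open>u\<close> and \<open>?y\<close> that is untouched by \<open>x\<close>;
        its vertex \<open>a\<close> is then the only old neighbour of \<open>u\<close> on the
        route.\<close>
      case False
      have y: "?y \<in> set rs" using sp by simp
      then obtain H2 where H2: "H2 \<in> holes V E" "u \<in> H2" "?y \<in> H2"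
        using Fu(3)[of ?y] False by (auto simp: fillin_def)
      have "u \<noteq> ?y" using ps(3) y sp by auto
      moreover have "x \<noteq> ?y" "\<not> E ?y x"
        using y s(3) s6[OF y] graph_sym[OF G, of ?y x] by (auto simp: fillin_def)
      moreover have "{x} \<subseteq> V" using hole_subset[OF H(1)] H(3) by auto
      ultimately have y2: "u \<noteq> ?y" "{x} \<subseteq> V" "u \<notin> {x}" "?y \<notin> {x}" "\<And>v. v \<in> {x} \<Longrightarrow> \<not> E ?y v"
        using ux by auto
      obtain A a c where A: "A \<subseteq> H2" "connected_in E A" "u \<notin> A" "?y \<notin> A"
        "{v \<in> A. E u v} = {a}" "{v \<in> A. E ?y v} = {c}"
        "{x} \<inter> A = {}" "\<forall>w\<in>{x}. \<forall>v\<in>A. \<not> E w v"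
        using NC_vertex_free_side[OF G NC H2 y2(1) False connected_in_singleton y2(2-5)] .
      have "connected_in E (set rs \<union> A)"
        by (rule connected_in_Un[OF G X A(2) y, of c]) (use A(6) in auto)
      moreover have "set rs \<union> A \<subseteq> V" using rsV A(1) hole_subset[OF H2(1)] by blast
      moreover have "{v \<in> set rs \<union> A. E u v} = {a}"
        using A(5) Fu(3) False by (auto simp: fillin_def)
      moreover have "u \<notin> set rs \<union> A" "x \<notin> set rs \<union> A" using ps(3) sp A(3,7) s(3) by auto
      moreover have "\<And>v. v \<in> set rs \<union> A \<Longrightarrow> \<not> E x v"
        using A(8) s6 by (auto simp: fillin_def)
      ultimately show ?thesis
        by (intro NC_vertex_hole_through[OF G NC H ux q(1-3) UnI1[OF q(4)] q(5)])
    qed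
    then show False using Fu(2) q(2) by (auto simp: fillin_def)
  qed
  have "u \<notin> H" if H: "H \<in> holes V ?F" for H
  proof
    assume u: "u \<in> H"
    obtain ps where ps: "induced_path ?F ps" "length ps \<ge> 3" "u \<notin> set ps" "H = insert u (set ps)"
      "\<And>v. v \<in> set ps \<Longrightarrow> ?F u v \<longleftrightarrow> v = hd ps \<or> v = last ps"
      using hole_obtain_path[OF GF H u] by metis
    have ne: "ps \<noteq> []" using ps(2) by auto
    have psV: "set ps \<subseteq> V" using hole_subset[OF H] ps(4) by auto
    have 1: "E u (hd ps)" using no_path[OF ps(1,2,3,5) psV] by blast
    have 2: "E u (last ps)"
      using no_path[OF induced_path_rev[OF ps(1)]] ps ne psV by (auto simp: hd_rev last_rev)
    \<comment> \<open>With both ends old neighbours of \<open>u\<close>, the hole contains no added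
      edge and is a hole of the original graph.\<close>
    have Eu: "?F u v \<longleftrightarrow> E u v" if "v \<in> H" for v
      using that ps(4,5) 1 2 graph_irrefl[OF G] graph_irrefl[OF GF] by (auto simp: fillin_def)
    have "?F x y \<longleftrightarrow> E x y" if "x \<in> H" "y \<in> H" for x y
      using Eu[OF that(1)] Eu[OF that(2)] graph_commute[OF G, of x u] graph_commute[OF GF, of x u]
        fillin_other[of x "{u}" y V E] by auto
    then have HE: "H \<in> holes V E" using is_hole_cong[of H ?F E V] H by (auto simp: holes_def)
    obtain x q rs where sp: "ps = x # q # rs" "rs \<noteq> []"
      using ps(2) by (cases ps; cases "tl ps"; cases "tl (tl ps)") auto
    \<comment> \<open>The inner vertex \<open>q\<close> lies on an old hole with \<open>u\<close>,
      so the fill-in does join it to \<open>u\<close>.\<close>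
    have "\<not> ?F u q" using ps(1) ps(5)[of q] sp by (auto simp: induced_path_def)
    moreover have "q \<in> H" "q \<noteq> u" using sp ps by auto
    ultimately show False using HE u by (auto simp: fillin_def)
  qed
  then show ?thesis using avoid by blast
qed

lemma NC_set_hole_unique:
  assumes "graph V E" "NC_set V E C" "H \<in> holes V E" "u \<in> H" "v \<in> H" "u \<in> C" "v \<in> C"
  shows "u = v"
proof -
  have "finite (H \<inter> C)" using assms hole_subset[OF assms(3)] finite_subset[OF _ graph_finite] by blast
  moreover have "card (H \<inter> C) \<le> 1" using assms by (auto simp: NC_set_def)
  ultimately show ?thesis using assms card_le_Suc0_iff_eq[of "H \<inter> C"] by auto
qed

text \<open>Induction over the cover vertices. Holes of an intermediate fill-in are old holes
  missing \<open>D\<close>, so the next vertex \<open>u\<close> keeps the NC property and the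
  one-vertex case applies.\<close>

lemma holes_fillin:
  assumes G: "graph V E" and NC: "NC_set V E C" and D: "finite D" "D \<subseteq> C"
  shows "holes V (fillin V E D) = {H \<in> holes V E. H \<inter> D = {}}"
  using D
proof (induction rule: finite_induct)
  case empty
  have "fillin V E {} = E" by (auto simp: fillin_def fun_eq_iff)
  then show ?case by simp
next
  case (insert u D)
  let ?F = "fillin V E D"
  have IH: "holes V ?F = {H \<in> holes V E. H \<inter> D = {}}" using insert by simp
  have GF: "graph V ?F" using graph_fillin[OF G] .
  have uC: "u \<in> C" "D \<subseteq> C" using insert by auto
  \<comment> \<open>A hole contains at most one vertex of \<open>C\<close>, so the earlier additions
    affect no hole through \<open>u\<close>; hence the two ways of adding the edges at
    \<open>u\<close> agree.\<close>
  have at: "H \<in> holes V ?F \<longleftrightarrow> H \<in> holes V E" if "u \<in> H" for H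
    unfolding IH using NC_set_hole_unique[OF G NC _ that] uC insert(2) by blast
  have eq: "fillin V ?F {u} = fillin V E (insert u D)"
    using at by (auto simp: fillin_def fun_eq_iff)
  have "NC_vertex V ?F u"
    unfolding NC_vertex_def
  proof
    assume "\<exists>H\<in>holes_at V ?F u. \<exists>H'\<in>holes V ?F - holes_at V ?F u. share_consecutive_edges ?F H H'"
    then obtain H H' where H: "H \<in> holes V ?F" "u \<in> H" "H' \<in> holes V ?F" "u \<notin> H'"
      "share_consecutive_edges ?F H H'" by (auto simp: holes_at_def)
    have EF: "?F x y \<longleftrightarrow> E x y" if "x \<in> H" "y \<in> H" for x y
      using H(1) that by (intro fillin_other) (auto simp: IH)
    obtain x y z where "x \<noteq> z" "?F x y" "?F y z" "{x, y, z} \<subseteq> H" "{x, y, z} \<subseteq> H'"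
      using H(5) unfolding share_consecutive_edges_def by blast
    then have "share_consecutive_edges E H H'"
      unfolding share_consecutive_edges_def using EF[of x y] EF[of y z]
      by (intro exI[of _ x] exI[of _ y] exI[of _ z]) auto
    moreover have "NC_vertex V E u" using NC uC by (auto simp: NC_set_def)
    ultimately show False using H IH unfolding NC_vertex_def holes_at_def by blast
  qed
  from holes_fillin_vertex[OF GF this] show ?case unfolding eq IH by auto
qed

section \<open>Cliques of the fill-in and complete minors\<close>

text \<open>Every pair of \<open>K\<close> joined only by an added edge consists of a vertex in
  \<open>C\<close> and one outside. Two such pairs with different vertices in \<open>C\<close> would
  produce a hole with two vertices of \<open>C\<close>, so all these pairs meet one vertex
  \<open>u\<close>.\<close>

lemma fillin_clique:
  assumes G: "graph V E" and NC: "NC_set V E C" and K: "clique V (fillin V E C) K"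
  obtains u where "clique V E (K - {u})"
proof -
  let ?F = "fillin V E C"
  have NCv: "NC_vertex V E u" if "u \<in> C" for u using NC that by (auto simp: NC_set_def)
  have KV: "K \<subseteq> V" and F: "\<And>x y. x \<in> K \<Longrightarrow> y \<in> K \<Longrightarrow> x \<noteq> y \<Longrightarrow> ?F x y"
    using K by (auto simp: clique_def)
  note uniq = NC_set_hole_unique[OF G NC]
  \<comment> \<open>An added edge inside \<open>C\<close> would need a hole with two vertices of
    \<open>C\<close>.\<close>
  have EC: "E u v" if "u \<in> C \<longleftrightarrow> v \<in> C" "u \<in> K" "v \<in> K" "u \<noteq> v" for u v
    using F[OF that(2-4)] uniq that by (auto simp: fillin_def)
  \<comment> \<open>The case of a shared vertex \<open>w\<close>. Untouched sides \<open>A1\<close>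
    and \<open>A2\<close> meet at \<open>w\<close> and form a route from \<open>u1\<close> to
    \<open>u2\<close> on which \<open>u1\<close> sees only \<open>a1\<close> and \<open>u2\<close>;
    with the edge between \<open>u1\<close> and \<open>u2\<close> it gives a hole containing
    both.\<close>
  have common: False
    if u: "u1 \<in> C" "u2 \<in> C" "u1 \<in> K" "u2 \<in> K" "u1 \<noteq> u2" and w: "w \<in> K" "w \<notin> C" "\<not> E u1 w" "\<not> E u2 w"
    for u1 u2 w
  proof -
    have u12: "E u1 u2" using EC u by blast
    have ne: "u1 \<noteq> w" "u2 \<noteq> w" using u w by auto
    obtain H1 where H1: "H1 \<in> holes V E" "u1 \<in> H1" "w \<in> H1" using F[OF u(3) w(1) ne(1)] w(3) by (auto simp: fillin_def)
    obtain H2 where H2: "H2 \<in> holes V E" "u2 \<in> H2" "w \<in> H2" using F[OF u(4) w(1) ne(2)] w(4) by (auto simp: fillin_def)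
    have nw: "\<not> E w u1" "\<not> E w u2" using w graph_commute[OF G] by auto
    obtain A1 a1 c1 where A1: "A1 \<subseteq> H1" "connected_in E A1" "u1 \<notin> A1" "w \<notin> A1"
        "{v \<in> A1. E u1 v} = {a1}" "{v \<in> A1. E w v} = {c1}"
        "{u2} \<inter> A1 = {}" "\<forall>x\<in>{u2}. \<forall>v\<in>A1. \<not> E x v"
      using NC_vertex_free_side[OF G NCv[OF u(1)] H1 ne(1) w(3) connected_in_singleton[of E u2]]
        u KV ne nw by blast
    obtain A2 a2 c2 where A2: "A2 \<subseteq> H2" "connected_in E A2" "u2 \<notin> A2" "w \<notin> A2"
        "{v \<in> A2. E u2 v} = {a2}" "{v \<in> A2. E w v} = {c2}"
        "{u1} \<inter> A2 = {}" "\<forall>x\<in>{u1}. \<forall>v\<in>A2. \<not> E x v"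
      using NC_vertex_free_side[OF G NCv[OF u(2)] H2 ne(2) w(4) connected_in_singleton[of E u1]]
        u KV ne nw by blast
    have m: "a1 \<in> A1" "E u1 a1" "c1 \<in> A1" "E w c1" "a2 \<in> A2" "E u2 a2" "c2 \<in> A2" "E w c2"
      using A1(5,6) A2(5,6) by auto
    have "connected_in E (insert w A1)" "connected_in E (insert u2 A2)"
      using connected_in_insert[OF G A1(2) m(3) graph_sym[OF G m(4)]]
        connected_in_insert[OF G A2(2) m(5) graph_sym[OF G m(6)]] .
    then have D: "connected_in E (insert w A1 \<union> insert u2 A2)"
      using connected_in_Un[OF G, of "insert w A1" "insert u2 A2" w c2] m by blast
    have DV: "insert w A1 \<union> insert u2 A2 \<subseteq> V"
      using hole_subset[OF H1(1)] hole_subset[OF H2(1)] A1(1) A2(1) H1 H2 by blast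
    obtain H where "H \<in> holes V E" "{a1, u1, u2} \<subseteq> H"
    proof (rule hole_from_connected[OF G D DV, where y = u1 and x = a1 and z = u2])
      show "u1 \<notin> insert w A1 \<union> insert u2 A2" using ne u A1(3) A2(7) by auto
      show "a1 \<in> insert w A1 \<union> insert u2 A2" "u2 \<in> insert w A1 \<union> insert u2 A2"
        "a1 \<noteq> u2" "E u1 a1" "E u1 u2" using m A1(7) u12 by auto
      show "\<not> E a1 u2" using A1(8) m(1) graph_commute[OF G] by auto
      show "v = a1 \<or> v = u2" if "v \<in> insert w A1 \<union> insert u2 A2" "E u1 v" for v
        using that w(3) A1(5) A2(8) by blast
    qed (rule that)
    then show False using uniq u by blast
  qed
  \<comment> \<open>Two disjoint missing pairs are the diagonals of the 4-cycle \<open>u1\<close>,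
    \<open>w2\<close>, \<open>w1\<close>, \<open>u2\<close>, which is then a hole with two vertices
    of \<open>C\<close>.\<close>
  have single: "u1 = u2"
    if u: "u1 \<in> C" "u2 \<in> C" "u1 \<in> K" "u2 \<in> K" and w: "w1 \<in> K" "w2 \<in> K" "w1 \<notin> C" "w2 \<notin> C"
      and n: "\<not> E u1 w1" "\<not> E u2 w2" for u1 u2 w1 w2
  proof (rule ccontr)
    assume ne: "u1 \<noteq> u2"
    have e1: "E u1 w2" and e2: "E u2 w1" using common[OF u ne] w n by blast+
    then have "w1 \<noteq> w2" using n by auto
    then have e: "E w2 w1" "E u1 u2" using EC w u ne by auto
    have "connected_in E (insert u2 (insert w1 {w2}))"
      by (intro connected_in_insert[OF G _ _ graph_sym[OF G e2], of "insert w1 {w2}"]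
          connected_in_insert[OF G _ _ e(1), of "{w2}"] connected_in_singleton) auto
    then obtain H where "H \<in> holes V E" "{w2, u1, u2} \<subseteq> H"
      by (rule hole_from_connected[OF G, where y = u1 and x = w2 and z = u2])
        (use u w KV ne n e e1 graph_commute[OF G, of u2 w2] in blast)+
    then show False using uniq u ne by blast
  qed
  show thesis
  proof (cases "\<exists>u\<in>K \<inter> C. \<exists>w\<in>K - C. \<not> E u w")
    case True
    then obtain u w where uw: "u \<in> K" "u \<in> C" "w \<in> K" "w \<notin> C" "\<not> E u w" by blast
    have e: "E x y" if "x \<in> K - {u}" "y \<in> K - {u}" "x \<in> C" "y \<notin> C" for x y
      using single[of x u y w] uw that by blast
    have "E x y" if "x \<in> K - {u}" "y \<in> K - {u}" "x \<noteq> y" for x y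
      using that e[of x y] e[of y x] EC[of x y] graph_sym[OF G, of y x] by blast
    then show thesis using that[of u] KV unfolding clique_def by blast
  next
    case False
    have "E x y" if "x \<in> K" "y \<in> K" "x \<noteq> y" for x y
      using that False EC[of x y] graph_sym[OF G, of y x] by blast
    then show thesis using that KV unfolding clique_def by blast
  qed
qed

text \<open>All branch sets are singletons except that of \<open>u\<close>, which absorbs for each
  \<open>w\<close> not adjacent to \<open>u\<close> one side of a hole through \<open>u\<close> and
  \<open>w\<close>.\<close>

lemma fillin_clique_minor:
  assumes G: "graph V E" and K: "clique V (fillin V E C) K" and u: "clique V E (K - {u})"
    and n: "n \<le> card K"
  shows "has_complete_minor V E n"
proof -
  have KV: "K \<subseteq> V" using K by (auto simp: clique_def)
  then have fin: "finite K" using graph_finite[OF G] finite_subset by blast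
  have "\<exists>B. connected_in E B \<and> u \<in> B \<and> B \<subseteq> V \<and> B \<inter> (K - {u}) = {} \<and> (\<exists>x\<in>B. E x w)"
    if uK: "u \<in> K" and w: "w \<in> K - {u}" for w
  proof (cases "E u w")
    case True
    then show ?thesis using connected_in_singleton[of E u] uK KV by (intro exI[of _ "{u}"]) auto
  next
    case False
    have "fillin V E C u w" using K uK w by (auto simp: clique_def)
    then obtain H where H: "H \<in> holes V E" "u \<in> H" "w \<in> H" using False by (auto simp: fillin_def)
    have ne: "u \<noteq> w" using w by auto
    obtain A B a b c d where s: "H = {u, w} \<union> A \<union> B" "u \<notin> A" "u \<notin> B" "w \<notin> A" "w \<notin> B" "A \<inter> B = {}"
      and con: "connected_in E A" "connected_in E B"
      and n: "{v \<in> A. E u v} = {a}" "{v \<in> B. E u v} = {b}"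
        "{v \<in> A. E w v} = {c}" "{v \<in> B. E w v} = {d}"
      and AB: "\<forall>x\<in>A. \<forall>y\<in>B. \<not> E x y"
      using hole_two_sides[OF G H ne False] .
    have m: "a \<in> A" "E a u" "b \<in> B" "E b u" "c \<in> A" "E c w" "d \<in> B" "E d w"
      using n graph_commute[OF G, of _ u] graph_commute[OF G, of _ w] by auto
    have HV: "H \<subseteq> V" using hole_subset[OF H(1)] .
    \<comment> \<open>There are no edges between the two sides, whereas \<open>K - {u}\<close> is a
      clique of the original graph, so it cannot meet both.\<close>
    have "A \<inter> (K - {u}) = {} \<or> B \<inter> (K - {u}) = {}"
    proof (rule ccontr)
      assume "\<not> ?thesis"
      then obtain x y where xy: "x \<in> A" "y \<in> B" "x \<in> K - {u}" "y \<in> K - {u}" by blast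
      then have "x \<noteq> y" using s(6) by blast
      then have "E x y" using u xy by (simp add: clique_def)
      then show False using AB xy by blast
    qed
    then show ?thesis
    proof
      assume "A \<inter> (K - {u}) = {}"
      then show ?thesis using connected_in_insert[OF G con(1) m(1,2)] m s(1) HV
        by (intro exI[of _ "insert u A"]) auto
    next
      assume "B \<inter> (K - {u}) = {}"
      then show ?thesis using connected_in_insert[OF G con(2) m(3,4)] m s(1) HV
        by (intro exI[of _ "insert u B"]) auto
    qed
  qed
  \<comment> \<open>The condition \<open>u \<in> K\<close> is carried along because \<open>u\<close>
    may lie outside \<open>K\<close>, and then only singletons are used.\<close>
  then obtain B where B: "\<And>w. u \<in> K \<Longrightarrow> w \<in> K - {u} \<Longrightarrow> connected_in E (B w) \<and> u \<in> B w \<and> B w \<subseteq> V \<and>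
      B w \<inter> (K - {u}) = {} \<and> (\<exists>x\<in>B w. E x w)" by metis
  define U where "U = insert u (\<Union>w\<in>K - {u}. B w)"
  have U: "connected_in E U" "U \<subseteq> V" "U \<inter> (K - {u}) = {}" "\<And>w. w \<in> K - {u} \<Longrightarrow> \<exists>x\<in>U. E x w"
    if uK: "u \<in> K"
  proof -
    show "connected_in E U" unfolding U_def using B[OF uK] by (intro connected_in_UN[OF G]) auto
    show "U \<subseteq> V" "U \<inter> (K - {u}) = {}" using B[OF uK] uK KV unfolding U_def by blast+
    show "\<exists>x\<in>U. E x w" if "w \<in> K - {u}" for w using B[OF uK that] that unfolding U_def by blast
  qed
  obtain e where e: "bij_betw e {0..<card K} K" using ex_bij_betw_nat_finite[OF fin] by blast
  have eK: "e i \<in> K" if "i < n" for i using e that n by (auto simp: bij_betw_def)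
  have einj: "e i \<noteq> e j" if "i < n" "j < n" "i \<noteq> j" for i j
    using e that n by (auto simp: bij_betw_def inj_on_def)
  let ?B = "\<lambda>i. if e i = u then U else {e i}"
  show ?thesis unfolding has_complete_minor_def
  proof (intro exI[of _ ?B] conjI allI impI)
    fix i assume i: "i < n"
    show "?B i \<noteq> {}" by (auto simp: U_def)
    show "?B i \<subseteq> V" using U(2) eK[OF i] KV by auto
    show "connected_in E (?B i)" using U(1) eK[OF i] by (auto simp: connected_in_singleton)
  next
    fix i j assume ij: "i < n" "j < n" "i \<noteq> j"
    note k = eK[OF ij(1)] eK[OF ij(2)] einj[OF ij]
    show "?B i \<inter> ?B j = {}" using k U(3) by auto
    show "\<exists>x\<in>?B i. \<exists>y\<in>?B j. E x y"
    proof (cases "e i = u \<or> e j = u")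
      case True
      then show ?thesis using k U(4)[of "e i"] U(4)[of "e j"] graph_commute[OF G] by auto
    next
      case False
      then show ?thesis using k u by (auto simp: clique_def)
    qed
  qed
qed

section \<open>Greedy colouring along a chordal supergraph\<close>

text \<open>Dirac's argument: the neighbourhood of a component of \<open>W - N[y]\<close> is a clique.\<close>

lemma chordal_simplicial_nonneighbour:
  assumes G: "graph V F" and chordal: "holes V F = {}"
    and "W \<subseteq> V" "y \<in> W" "z \<in> W" "y \<noteq> z" "\<not> F y z"
  shows "\<exists>v\<in>W. v \<noteq> y \<and> \<not> F y v \<and> clique V F (insert v {x \<in> W. F v x})"
  using assms(3-)
proof (induction "card W" arbitrary: W y z rule: less_induct)
  case less
  have finW: "finite W" using less.prems(1) graph_finite[OF G] finite_subset by blast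
  let ?R = "{v \<in> W. v \<noteq> y \<and> \<not> F y v}"
  \<comment> \<open>A set of maximal size with this property is the component of \<open>z\<close>
    among the nonneighbours of \<open>y\<close> in \<open>W\<close>.\<close>
  define P where "P D \<longleftrightarrow> D \<subseteq> ?R \<and> z \<in> D \<and> connected_in F D" for D
  have "P {z}" using less.prems connected_in_singleton by (auto simp: P_def)
  moreover have "\<forall>D. P D \<longrightarrow> card D < Suc (card W)"
    using card_mono[OF finW] unfolding P_def by (metis (lifting) less_Suc_eq_le mem_Collect_eq subset_eq)
  ultimately obtain D where D: "P D" and max: "\<And>D'. P D' \<Longrightarrow> card D' \<le> card D"
    using ex_has_greatest_nat[of P _ card] by blast
  have DR: "D \<subseteq> ?R" and zD: "z \<in> D" and con: "connected_in F D" using D by (auto simp: P_def)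
  have finD: "finite D" using DR finW by (auto intro: finite_subset)
  define S where "S = {s \<in> W. F y s \<and> (\<exists>d\<in>D. F s d)}"
  have closed: "x \<in> D \<union> S" if "d \<in> D" "F d x" "x \<in> W" for d x
  proof (rule ccontr)
    assume x: "x \<notin> D \<union> S"
    have "F x d" using graph_sym[OF G that(2)] .
    then have "x \<noteq> y" "\<not> F y x" using x that DR by (auto simp: S_def)
    then have "P (insert x D)"
      using D that connected_in_insert[OF G con that(1,2)] by (auto simp: P_def)
    then show False using max[of "insert x D"] x finD by auto
  qed
  \<comment> \<open>Nonadjacent \<open>s\<close> and \<open>t\<close> would be linked through
    \<open>D\<close>, where \<open>y\<close> has no neighbours, and \<open>y\<close> would close
    this link to a hole.\<close>
  have S: "F s t" if st: "s \<in> S" "t \<in> S" "s \<noteq> t" for s t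
  proof (rule ccontr)
    assume nF: "\<not> F s t"
    obtain d1 d2 where d: "d1 \<in> D" "F d1 s" "d2 \<in> D" "F d2 t"
      using st graph_sym[OF G] unfolding S_def by blast
    have "connected_in F (insert t (insert s D))"
      using connected_in_insert[OF G connected_in_insert[OF G con d(1,2)] _ d(4)] d(3) by blast
    then obtain H where "H \<in> holes V F"
    proof (rule hole_from_connected[OF G, where y = y and x = s and z = t])
      show "insert t (insert s D) \<subseteq> V" using st DR less.prems(1) by (auto simp: S_def)
      show "y \<notin> insert t (insert s D)" using st DR graph_irrefl[OF G] by (auto simp: S_def)
      show "v = s \<or> v = t" if "v \<in> insert t (insert s D)" "F y v" for v
        using that DR by auto
    qed (use st nF that in \<open>auto simp: S_def\<close>)
    then show False using chordal by simp
  qed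
  \<comment> \<open>This set misses \<open>y\<close> and contains all neighbours in \<open>W\<close>
    of vertices of \<open>D\<close>, so a vertex of \<open>D\<close> that is simplicial here is
    simplicial in \<open>W\<close>.\<close>
  let ?W = "D \<union> S"
  have sub: "?W \<subseteq> W" using DR by (auto simp: S_def)
  have "y \<notin> ?W" using DR graph_irrefl[OF G] by (auto simp: S_def)
  then have "?W \<subset> W" using sub less.prems(2) by auto
  then have card: "card ?W < card W" using finW psubset_card_mono by blast
  have WV: "?W \<subseteq> V" using sub less.prems(1) by auto
  \<comment> \<open>The induction hypothesis might return a vertex of \<open>S\<close>. The choice
    of \<open>y'\<close> prevents this: it lies in the clique \<open>S\<close>, or \<open>S\<close>
    is complete to \<open>D\<close>; in both cases \<open>y'\<close> is adjacent to every other
    vertex of \<open>S\<close>. If no such pair exists, \<open>?W\<close> is a clique and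
    \<open>z\<close> will do.\<close>
  have "\<exists>v\<in>D. clique V F (insert v {x \<in> ?W. F v x})"
  proof (cases "\<exists>y'\<in>?W. \<exists>z'\<in>D. y' \<noteq> z' \<and> \<not> F y' z' \<and> (y' \<in> S \<or> (\<forall>s\<in>S. \<forall>d\<in>D. F s d))")
    case True
    then obtain y' z' where yz: "y' \<in> ?W" "z' \<in> D" "y' \<noteq> z'" "\<not> F y' z'"
      "y' \<in> S \<or> (\<forall>s\<in>S. \<forall>d\<in>D. F s d)" by blast
    obtain v where v: "v \<in> ?W" "v \<noteq> y'" "\<not> F y' v" "clique V F (insert v {x \<in> ?W. F v x})"
      using less.hyps[OF card WV yz(1) _ yz(3,4)] yz(2) by blast
    have "v \<in> D"
    proof (rule ccontr)
      assume "v \<notin> D"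
      then have "v \<in> S" using v(1) by simp
      then have "F v y'" using yz(1,5) S[of v y'] v(2) by auto
      then show False using v(3) graph_sym[OF G] by blast
    qed
    then show ?thesis using v(4) by blast
  next
    case False
    have SD: "\<forall>s\<in>S. \<forall>d\<in>D. F s d"
    proof (intro ballI)
      fix s d assume "s \<in> S" "d \<in> D"
      moreover from this have "s \<noteq> d" using DR by (auto simp: S_def)
      ultimately show "F s d" using False by blast
    qed
    have "F x x'" if "x \<in> ?W" "x' \<in> ?W" "x \<noteq> x'" for x x'
      using that False SD S graph_sym[OF G] by blast
    then have "clique V F (insert z {x \<in> ?W. F z x})"
      using WV zD unfolding clique_def by blast
    then show ?thesis using zD by blast
  qed
  then obtain v where v: "v \<in> D" "clique V F (insert v {x \<in> ?W. F v x})" by blast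
  have "{x \<in> W. F v x} = {x \<in> ?W. F v x}" using closed[OF v(1)] sub by blast
  then show ?case using v DR by auto
qed

lemma chordal_simplicial:
  assumes G: "graph V F" and chordal: "holes V F = {}" and W: "W \<subseteq> V" "W \<noteq> {}"
  obtains v where "v \<in> W" "clique V F (insert v {x \<in> W. F v x})"
proof (cases "\<exists>y\<in>W. \<exists>z\<in>W. y \<noteq> z \<and> \<not> F y z")
  case True
  then show thesis using chordal_simplicial_nonneighbour[OF G chordal W(1)] that by blast
next
  case False
  obtain v where v: "v \<in> W" using W(2) by blast
  have "clique V F (insert v {x \<in> W. F v x})" using False v W(1) unfolding clique_def by blast
  then show thesis using that v by blast
qed

text \<open>A vertex simplicial in \<open>F\<close> is coloured last. Together with its neighbours
  it forms a clique of at most \<open>k\<close> vertices, so at most \<open>k - 1\<close> neighbours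
  each forbid at most one colour.\<close>

lemma DP_colourable_chordal_supergraph:
  assumes G: "graph V E" and GF: "graph V F" and EF: "\<And>x y. E x y \<Longrightarrow> F x y"
    and chordal: "holes V F = {}" and k: "\<And>K. clique V F K \<Longrightarrow> card K \<le> k"
  shows "DP_colourable V E k"
  unfolding DP_colourable_def
proof (intro allI impI)
  fix M assume M: "correspondence V E k M"
  have Msym: "M u v i j \<longleftrightarrow> M v u j i" for u v i j using M unfolding correspondence_def by blast
  have Mfun: "j = j'" if "E u v" "i < k" "j < k" "j' < k" "M u v i j" "M u v i j'" for u v i j j'
    using M that unfolding correspondence_def by blast
  have "\<exists>f. (\<forall>v\<in>W. f v < k) \<and> (\<forall>u\<in>W. \<forall>v\<in>W. E u v \<longrightarrow> \<not> M u v (f u) (f v))" if "W \<subseteq> V" for W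
    using that
  proof (induction "card W" arbitrary: W)
    case 0
    then have "W = {}" using finite_subset[OF _ graph_finite[OF G]] by auto
    then show ?case by simp
  next
    case (Suc n)
    have finW: "finite W" using Suc.prems graph_finite[OF G] finite_subset by blast
    have "W \<noteq> {}" using Suc.hyps(2) by auto
    then obtain v where v: "v \<in> W" "clique V F (insert v {x \<in> W. F v x})"
      using chordal_simplicial[OF GF chordal Suc.prems] by blast
    have "n = card (W - {v})" "W - {v} \<subseteq> V" using Suc v finW by auto
    then obtain f where f: "\<forall>u\<in>W - {v}. f u < k"
      "\<forall>u\<in>W - {v}. \<forall>w\<in>W - {v}. E u w \<longrightarrow> \<not> M u w (f u) (f w)" using Suc.hyps(1) by blast
    let ?N = "{x \<in> W. F v x}" and ?N' = "{x \<in> W. E v x}"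
    have "card (insert v ?N) = Suc (card ?N)" using finW graph_irrefl[OF GF] by simp
    then have cN: "Suc (card ?N) \<le> k" using k[OF v(2)] by simp
    have "card ?N' \<le> card ?N" using EF finW by (intro card_mono) auto
    then have cN': "card ?N' < k" using cN by simp
    \<comment> \<open>The colour that \<open>x\<close> forbids at \<open>v\<close>, unique since the
      correspondence is a matching. If there is none, the arbitrary value merely excludes one colour
      more, without affecting the count.\<close>
    define bad where "bad x = (SOME j. j < k \<and> M x v (f x) j)" for x
    have "card (bad ` ?N') < k" using card_image_le[of ?N' bad] finW cN' by auto
    then have "\<not> {..<k} \<subseteq> bad ` ?N'"
      using card_mono[of "bad ` ?N'" "{..<k}"] finW by auto
    then obtain c where c: "c < k" "c \<notin> bad ` ?N'" by auto
    have ok: "\<not> M x v (f x) c" if x: "x \<in> W" "E v x" for x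
    proof
      assume m: "M x v (f x) c"
      then have "bad x < k \<and> M x v (f x) (bad x)"
        unfolding bad_def using c(1) by (intro someI[of "\<lambda>j. j < k \<and> M x v (f x) j" c]) auto
      moreover have "f x < k" using f(1) x graph_irrefl[OF G] by auto
      ultimately have "bad x = c" using Mfun[OF graph_sym[OF G x(2)]] m c(1) by blast
      then show False using c(2) x by auto
    qed
    have "\<not> M u w ((f(v := c)) u) ((f(v := c)) w)" if "u \<in> W" "w \<in> W" "E u w" for u w
      using that f(2) ok[of u] ok[of w] graph_irrefl[OF G] graph_sym[OF G that(3)] Msym[of u w]
      by auto
    then show ?case using f(1) c(1) by (intro exI[of _ "f(v := c)"]) auto
  qed
  then obtain f where "\<forall>v\<in>V. f v < k" "\<forall>u\<in>V. \<forall>v\<in>V. E u v \<longrightarrow> \<not> M u v (f u) (f v)" by blast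
  then show "\<exists>f. M_colouring V E k M f"
    unfolding M_colouring_def using graph_in1[OF G] graph_in2[OF G] by blast
qed

section \<open>Assembling the two bounds\<close>

lemma card_clique_le_clique_number:
  assumes G: "graph V E" and K: "clique V E K"
  shows "card K \<le> clique_number V E"
  unfolding clique_number_def
proof (rule Max_ge)
  have "{card K |K. clique V E K} \<subseteq> {..card V}"
    using card_mono[OF graph_finite[OF G]] by (auto simp: clique_def)
  then show "finite {card K |K. clique V E K}" using finite_subset by blast
qed (use K in blast)

theorem theorem1:
  fixes V :: "'a set" and E :: "'a \<Rightarrow> 'a \<Rightarrow> bool"
  assumes "graph V E"
    and "NC_graph V E"
  shows "chi_DP V E \<le> clique_number V E + 1 \<and>
         (\<forall>n::nat. \<not> has_complete_minor V E n \<longrightarrow> chi_DP V E \<le> n - 1)"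
proof -
  obtain C where C: "hole_cover V E C" "NC_set V E C" using assms(2) by (auto simp: NC_graph_def)
  let ?F = "fillin V E C"
  have "finite C" using C(1) graph_finite[OF assms(1)] finite_subset by (auto simp: hole_cover_def)
  \<comment> \<open>Every hole meets the cover, so none survives in the fill-in.\<close>
  then have chordal: "holes V ?F = {}"
    using holes_fillin[OF assms(1) C(2)] C(1) by (auto simp: hole_cover_def)
  \<comment> \<open>Both bounds reduce to bounding the cliques of the fill-in.\<close>
  have chi: "chi_DP V E \<le> k" if "\<And>K. clique V ?F K \<Longrightarrow> card K \<le> k" for k
  proof -
    have "DP_colourable V E k"
      by (rule DP_colourable_chordal_supergraph[OF assms(1) graph_fillin[OF assms(1)] _ chordal that])
        (auto simp: fillin_def)
    then show ?thesis unfolding chi_DP_def by (rule Least_le)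
  qed
  show ?thesis
  proof (intro conjI allI impI)
    show "chi_DP V E \<le> clique_number V E + 1"
    proof (rule chi)
      fix K assume "clique V ?F K"
      then obtain u where "clique V E (K - {u})" using fillin_clique[OF assms(1) C(2)] by blast
      then have "card (K - {u}) \<le> clique_number V E"
        by (rule card_clique_le_clique_number[OF assms(1)])
      then show "card K \<le> clique_number V E + 1"
        using diff_card_le_card_Diff[of "{u}" K] by simp
    qed
  next
    fix n assume n: "\<not> has_complete_minor V E n"
    show "chi_DP V E \<le> n - 1"
    proof (rule chi)
      fix K assume K: "clique V ?F K"
      then obtain u where "clique V E (K - {u})" using fillin_clique[OF assms(1) C(2)] by blast
      then have "\<not> n \<le> card K" using fillin_clique_minor[OF assms(1) K] n by blast
      \<comment> \<open>Truncated subtraction is harmless: \<open>card K < n\<close> makes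
        \<open>n\<close> positive.\<close>
      then show "card K \<le> n - 1" by simp
    qed
  qed
qed

end
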